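(* Let $k\ge 2$ and $c\ge 1$ be natural numbers such that $$\frac{1}{c}\leq \Big(\frac{1}{k^2+2k-1}\Big)^{\frac{1}{k-1}}\Big(1-\frac{1}{k^2+2k-1}\Big)^{\frac{2k-2+k^2}{k-1}} .$$ Then for every Candy Crush grid $H=(V,E)$ with parameter $k$, the existence of a $k$-stable $c$-colouring of $H$ is guaranteed through the Lovász Local Lemma. That is, if the vertices of $H$ are coloured independently and uniformly at random from $\{1,\dots,c\}$ and $B_e$ denotes the event that the hyperedge $e\in E$ is monochromatic, then there is a function $f:E\to(0,1)$ such that for all $e\in E$ $$\Pr(B_e)\le f(e)\prod_{e'\in\Gamma(e)}(1-f(e')),$$ where $\Gamma(e)=\{e'\in E: e'\neq e,\ e'\cap e\neq\emptyset\}$; and consequently $H$ has a $k$-stable $c$-colouring.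
   Context: Candy Crush grid: given natural numbers $m,n,k$, a Candy Crush grid with parameter $k$ is a $k$-uniform hypergraph $H=(V,E)$ with $V\subseteq\{1,\dots,n\}\times\{1,\dots,m\}$, whose hyperedges are all the subsets of $V$ of the form $\{(i,j),(i,j+1),\dots,(i,j+k-1)\}$ or $\{(i,j),(i+1,j),\dots,(i+k-1,j)\}$. A $c$-colouring of $H$ is a map $\phi:V\to\{1,\dots,c\}$. A hyperedge is monochromatic under $\phi$ if $\phi$ is constant on it. A $k$-stable $c$-colouring (also called a weak proper $c$-colouring, or a stable Candy Crush grid) is a $c$-colouring with no monochromatic hyperedge. *)

theory Defs
  imports "HOL-Probability.Probability"
begin

definition column_line :: "nat \<Rightarrow> nat \<times> nat \<Rightarrow> (nat \<times> nat) set" where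
  "column_line k = (\<lambda>(i, j). {(i, j + t) | t. t < k})"

definition row_line :: "nat \<Rightarrow> nat \<times> nat \<Rightarrow> (nat \<times> nat) set" where
  "row_line k = (\<lambda>(i, j). {(i + t, j) | t. t < k})"

definition candy_crush_grid ::
  "nat \<Rightarrow> nat \<Rightarrow> nat \<Rightarrow> (nat \<times> nat) set \<Rightarrow> (nat \<times> nat) set set \<Rightarrow> bool" where
  "candy_crush_grid m n k V E \<longleftrightarrow>
     V \<subseteq> {1..n} \<times> {1..m} \<and>
     E = {e. e \<subseteq> V \<and> (\<exists>p. e = column_line k p \<or> e = row_line k p)}"

lemma candy_crush_grid_uniform:
  assumes "candy_crush_grid m n k V E" and "e \<in> E"
  shows "card e = k"
proof -
  have "column_line k p = (\<lambda>t. (fst p, snd p + t)) ` {..<k}"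
    and "row_line k p = (\<lambda>t. (fst p + t, snd p)) ` {..<k}" for p
    by (auto simp: column_line_def row_line_def split: prod.splits)
  moreover have "inj_on (\<lambda>t. (fst p, snd p + t)) {..<k}"
    and "inj_on (\<lambda>t. (fst p + t, snd p)) {..<k}" for p :: "nat \<times> nat"
    by (auto simp: inj_on_def)
  ultimately show ?thesis
    using assms by (auto simp: candy_crush_grid_def card_image)
qed

definition colourings :: "'a set \<Rightarrow> nat \<Rightarrow> ('a \<Rightarrow> nat) set" where
  "colourings V c = V \<rightarrow>\<^sub>E {1..c}"

definition stable_colouring ::
  "'a set \<Rightarrow> 'a set set \<Rightarrow> nat \<Rightarrow> ('a \<Rightarrow> nat) \<Rightarrow> bool" where
  "stable_colouring V E c \<phi> \<longleftrightarrow> \<phi> \<in> colourings V c \<and> (\<forall>e\<in>E. \<not> \<phi> constant_on e)"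

text \<open>The default value \<^term>\<open>undefined\<close> outside \<open>V\<close> makes the support of the random
  colouring exactly \<open>colourings V c\<close>. For infinite \<open>V\<close> or for \<open>c = 0\<close> the definition
  is not meaningful.\<close>

definition random_colouring :: "'a set \<Rightarrow> nat \<Rightarrow> ('a \<Rightarrow> nat) pmf" where
  "random_colouring V c = Pi_pmf V undefined (\<lambda>_. pmf_of_set {1..c})"

definition mono_event :: "'a set \<Rightarrow> ('a \<Rightarrow> nat) set" where
  "mono_event e = {\<phi>. \<phi> constant_on e}"

definition edge_nbhd :: "'a set set \<Rightarrow> 'a set \<Rightarrow> 'a set set" where
  "edge_nbhd E e = {e' \<in> E. e' \<noteq> e \<and> e' \<inter> e \<noteq> {}}"

end

theory Submission
  imports Defs
begin

text \<open>
  Each line of length \<open>k\<close> meets at most \<open>2 (k - 1)\<close> other lines of its own direction (one for each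
  nonzero shift shorter than \<open>k\<close>) and at most \<open>k\<^sup>2\<close> lines of the other direction (\<open>k\<close> through each
  of its \<open>k\<close> cells), so the dependency degree is at most \<open>D = k\<^sup>2 + 2 k - 2\<close>
  (\<open>card_edge_nbhd_grid\<close>). A line is monochromatic with probability at most \<open>(1 / c)\<^bsup>k - 1\<^esup>\<close>
  (\<open>prob_mono_event_le\<close>). In the symmetric situation the best weight in the Local Lemma maximises
  \<open>p (1 - p)\<^bsup>D\<^esup>\<close>, which happens at \<open>p = 1 / (D + 1)\<close>; the assumed bound on \<open>1 / c\<close> is the
  \<open>(k - 1)\<close>-st root of \<open>(1 / c)\<^bsup>k - 1\<^esup> \<le> p (1 - p)\<^bsup>D\<^esup>\<close>. Hence the constant function \<open>p\<close> is the
  required weight function.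

  The existence of a stable colouring is then the Local Lemma itself (\<open>lovasz_local_lemma\<close>), whose
  independence hypothesis holds since the events attached to lines disjoint from \<open>e\<close> look only at
  colours outside \<open>e\<close>, and the colours on \<open>e\<close> and outside \<open>e\<close> are drawn independently
  (\<open>prob_Pi_pmf_indep\<close>).
\<close>

section \<open>The Lovasz Local Lemma\<close>

context prob_space
begin

text \<open>
  The inductive core of the Local Lemma, with the conditional probabilities multiplied out, so that
  no conditioning event has to be known to have positive probability beforehand. Split \<open>S\<close> into
  the neighbours \<open>S\<^sub>1\<close> of \<open>e\<close> and the rest \<open>S\<^sub>2\<close>. Independence from \<open>S\<^sub>2\<close> leaves
  the factor \<open>\<Prod>j\<in>\<Gamma> e. 1 - f j\<close>, and adding the members of \<open>S\<^sub>1\<close> to \<open>S\<^sub>2\<close> one by one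
  loses, by induction, no more than these factors.
\<close>

lemma lovasz_local_lemma_step:
  fixes A :: "'i \<Rightarrow> 'a set" and \<Gamma> :: "'i \<Rightarrow> 'i set" and f :: "'i \<Rightarrow> real"
  assumes fin: "finite E"
    and meas: "\<And>e. e \<in> E \<Longrightarrow> A e \<in> events"
    and nbhd: "\<And>e. e \<in> E \<Longrightarrow> \<Gamma> e \<subseteq> E"
    and f: "\<And>e. e \<in> E \<Longrightarrow> 0 < f e \<and> f e < 1"
    and indep: "\<And>e S. \<lbrakk>e \<in> E; S \<subseteq> E - insert e (\<Gamma> e)\<rbrakk> \<Longrightarrow>
        prob (A e \<inter> (space M - \<Union>(A ` S))) = prob (A e) * prob (space M - \<Union>(A ` S))"
    and bound: "\<And>e. e \<in> E \<Longrightarrow> prob (A e) \<le> f e * (\<Prod>j\<in>\<Gamma> e. 1 - f j)"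
    and "S \<subseteq> E" "e \<in> E - S"
  shows "prob (A e \<inter> (space M - \<Union>(A ` S))) \<le> f e * prob (space M - \<Union>(A ` S))"
  using finite_subset[OF \<open>S \<subseteq> E\<close> fin] assms(7,8)
proof (induction S arbitrary: e rule: finite_psubset_induct)
  case (psubset S)
  define N where "N T = space M - \<Union>(A ` T)" for T
  have N_meas: "N T \<in> events" if "T \<subseteq> E" for T
    unfolding N_def using that meas finite_subset[OF that fin] by (intro sets.Diff sets.finite_UN) auto
  define S1 where "S1 = S \<inter> \<Gamma> e"
  define S2 where "S2 = S - \<Gamma> e"
  have S2: "S2 \<subseteq> E" "S2 \<subseteq> S" and S12: "S1 \<union> S2 = S" "S1 \<inter> S2 = {}" and S1: "S1 \<subseteq> S"
    using psubset.prems by (auto simp: S1_def S2_def)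
  have peel: "(\<Prod>j\<in>T. 1 - f j) * prob (N S2) \<le> prob (N (T \<union> S2))" if "finite T" "T \<subseteq> S1" for T
    using that
  proof (induction T)
    case empty
    then show ?case by simp
  next
    case (insert j T)
    let ?T = "T \<union> S2"
    have j: "j \<in> E - ?T" and T: "?T \<subset> S" "?T \<subseteq> E"
      using insert psubset.prems S1 S2 S12 by auto
    have "prob (A j \<inter> N ?T) \<le> f j * prob (N ?T)"
      using psubset.IH[OF T(1) T(2) j] by (simp add: N_def)
    moreover have "prob (N (insert j ?T)) = prob (N ?T) - prob (A j \<inter> N ?T)"
    proof -
      have "N (insert j ?T) = N ?T - A j \<inter> N ?T" by (auto simp: N_def)
      then show ?thesis
        using finite_measure_Diff[of "N ?T" "A j \<inter> N ?T"] N_meas[OF T(2)] meas[of j] j by auto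
    qed
    ultimately have "(1 - f j) * prob (N ?T) \<le> prob (N (insert j ?T))"
      by (simp add: algebra_simps)
    moreover have "(1 - f j) * ((\<Prod>j\<in>T. 1 - f j) * prob (N S2)) \<le> (1 - f j) * prob (N ?T)"
      using insert f[of j] j by (intro mult_left_mono) auto
    ultimately show ?case
      using insert by (simp add: mult.assoc)
  qed
  have e: "e \<in> E" using psubset.prems by auto
  have \<Gamma>_fin: "finite (\<Gamma> e)" using nbhd[OF e] fin by (rule finite_subset)
  have "prob (A e \<inter> N S) \<le> prob (A e \<inter> N S2)"
    using S2 meas[OF e] N_meas by (intro finite_measure_mono) (auto simp: N_def)
  also have "\<dots> = prob (A e) * prob (N S2)"
    unfolding N_def using psubset.prems by (intro indep) (auto simp: S2_def)
  also have "\<dots> \<le> f e * (\<Prod>j\<in>\<Gamma> e. 1 - f j) * prob (N S2)"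
    using bound[OF e] by (intro mult_right_mono) auto
  also have "\<dots> \<le> f e * (\<Prod>j\<in>S1. 1 - f j) * prob (N S2)"
  proof -
    have "(\<Prod>j\<in>\<Gamma> e. 1 - f j) \<le> (\<Prod>j\<in>S1. 1 - f j)"
    proof -
      have f01: "0 \<le> 1 - f j" "1 - f j \<le> 1" if "j \<in> \<Gamma> e" for j
        using f[of j] nbhd[OF e] that by auto
      have "(\<Prod>j\<in>\<Gamma> e. 1 - f j) = (\<Prod>j\<in>\<Gamma> e - S1. 1 - f j) * (\<Prod>j\<in>S1. 1 - f j)"
        using \<Gamma>_fin by (intro prod.subset_diff) (auto simp: S1_def)
      also have "\<dots> \<le> 1 * (\<Prod>j\<in>S1. 1 - f j)"
        using f01 by (intro mult_right_mono prod_le_1 prod_nonneg) (auto simp: S1_def)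
      finally show ?thesis by simp
    qed
    then show ?thesis
      using f[OF e] by (intro mult_right_mono mult_left_mono) auto
  qed
  also have "\<dots> \<le> f e * prob (N S)"
    using peel[of S1] S12 \<Gamma>_fin f[OF e] by (simp add: S1_def mult.assoc)
  finally show ?case by (simp add: N_def)
qed

theorem lovasz_local_lemma:
  fixes A :: "'i \<Rightarrow> 'a set" and \<Gamma> :: "'i \<Rightarrow> 'i set" and f :: "'i \<Rightarrow> real"
  assumes fin: "finite E"
    and meas: "\<And>e. e \<in> E \<Longrightarrow> A e \<in> events"
    and nbhd: "\<And>e. e \<in> E \<Longrightarrow> \<Gamma> e \<subseteq> E"
    and f: "\<And>e. e \<in> E \<Longrightarrow> 0 < f e \<and> f e < 1"
    and indep: "\<And>e S. \<lbrakk>e \<in> E; S \<subseteq> E - insert e (\<Gamma> e)\<rbrakk> \<Longrightarrow>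
        prob (A e \<inter> (space M - \<Union>(A ` S))) = prob (A e) * prob (space M - \<Union>(A ` S))"
    and bound: "\<And>e. e \<in> E \<Longrightarrow> prob (A e) \<le> f e * (\<Prod>j\<in>\<Gamma> e. 1 - f j)"
  shows "0 < prob (space M - \<Union>(A ` E))"
proof -
  have "0 < prob (space M - \<Union>(A ` T))" if "T \<subseteq> E" for T
    using finite_subset[OF that fin] that
  proof (induction T)
    case empty
    then show ?case by (simp add: prob_space)
  next
    case (insert e T)
    let ?N = "space M - \<Union>(A ` T)"
    have N: "?N \<in> events"
      using insert meas by (intro sets.Diff sets.finite_UN) auto
    have "prob (A e \<inter> ?N) \<le> f e * prob ?N"
      using insert by (intro lovasz_local_lemma_step[OF assms]) auto
    also have "\<dots> < prob ?N"
      using insert f[of e] by auto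
    finally have "0 < prob (?N - A e \<inter> ?N)"
      using finite_measure_Diff[of ?N "A e \<inter> ?N"] N meas[of e] insert.prems by auto
    also have "?N - A e \<inter> ?N = space M - \<Union>(A ` insert e T)" by auto
    finally show ?case .
  qed
  then show ?thesis by simp
qed

end

section \<open>Random colourings\<close>

text \<open>
  Splitting a random function into its restrictions to \<open>e\<close> and to the complement of \<open>e\<close> gives an
  independent pair. The two hypotheses on \<open>X\<close> and \<open>Y\<close> say that each event is determined by one
  component of this pair.
\<close>

lemma prob_Pi_pmf_indep:
  fixes p :: "'a \<Rightarrow> 'b pmf"
  assumes fin: "finite V" and "e \<subseteq> V"
    and X: "\<And>\<phi> \<psi>. (\<And>x. x \<in> e \<Longrightarrow> \<phi> x = \<psi> x) \<Longrightarrow> \<phi> \<in> X \<longleftrightarrow> \<psi> \<in> X"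
    and Y: "\<And>\<phi> \<psi>. (\<And>x. x \<notin> e \<Longrightarrow> \<phi> x = \<psi> x) \<Longrightarrow> \<phi> \<in> Y \<longleftrightarrow> \<psi> \<in> Y"
  shows "measure_pmf.prob (Pi_pmf V d p) (X \<inter> Y) =
    measure_pmf.prob (Pi_pmf V d p) X * measure_pmf.prob (Pi_pmf V d p) Y"
proof -
  let ?P = "Pi_pmf e d p" and ?Q = "Pi_pmf (V - e) d p"
  define glue :: "('a \<Rightarrow> 'b) \<times> ('a \<Rightarrow> 'b) \<Rightarrow> 'a \<Rightarrow> 'b"
    where "glue = (\<lambda>(g, h) x. if x \<in> e then g x else h x)"
  have V: "Pi_pmf V d p = map_pmf glue (pair_pmf ?P ?Q)"
    using Pi_pmf_union[of e "V - e" d p] fin finite_subset[OF \<open>e \<subseteq> V\<close>] \<open>e \<subseteq> V\<close>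
    by (simp add: glue_def Un_absorb1)
  have glueX: "glue gh \<in> X \<longleftrightarrow> fst gh \<in> X" for gh
    by (rule X) (auto simp: glue_def split: prod.splits)
  have glueY: "glue gh \<in> Y \<longleftrightarrow> snd gh \<in> Y" for gh
    by (rule Y) (auto simp: glue_def split: prod.splits)
  have "measure_pmf.prob (pair_pmf ?P ?Q) (X \<times> Y) = measure_pmf.prob ?P X * measure_pmf.prob ?Q Y" for X Y
  proof -
    have "measure_pmf.prob (pair_pmf ?P ?Q) (X \<times> Y) =
        measure_pmf.prob (pair_pmf ?P ?Q) ((X \<inter> set_pmf ?P) \<times> (Y \<inter> set_pmf ?Q))"
      by (intro measure_prob_cong_0) (auto simp: pmf_pair set_pmf_iff)
    then show ?thesis
      by (simp add: measure_pmf_prob_product measure_Int_set_pmf)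
  qed
  moreover have "glue -` (X \<inter> Y) = X \<times> Y" "glue -` X = X \<times> UNIV" "glue -` Y = UNIV \<times> Y"
    using glueX glueY by auto
  ultimately show ?thesis
    by (simp add: V del: vimage_Int)
qed

text \<open>
  The colour can be chosen in \<open>c\<close> ways and is then taken by all of \<open>e\<close> with probability
  \<open>(1 / c)\<^bsup>card e\<^esup>\<close>. Nonemptiness of \<open>e\<close> forces the common colour to be one of the \<open>c\<close>
  admissible ones.
\<close>

lemma prob_mono_event_le:
  assumes fin: "finite V" and "e \<subseteq> V" "e \<noteq> {}" "c \<ge> 1"
  shows "measure_pmf.prob (random_colouring V c) (mono_event e) \<le> (1 / real c) ^ (card e - 1)"
proof -
  let ?R = "random_colouring V c"
  define C where "C a = Pi V (\<lambda>x. if x \<in> e then {a} else UNIV)" for a :: nat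
  have fin_e: "finite e" using assms finite_subset by auto
  obtain x where x: "x \<in> e" using assms by auto
  have supp: "set_pmf ?R = PiE_dflt V undefined (\<lambda>_. {1..c})"
    unfolding random_colouring_def using assms by (subst set_Pi_pmf) (simp_all add: o_def)
  have "measure_pmf.prob ?R (mono_event e) = measure_pmf.prob ?R (mono_event e \<inter> set_pmf ?R)"
    by (simp add: measure_Int_set_pmf)
  also have "\<dots> \<le> measure_pmf.prob ?R (\<Union>a\<in>{1..c}. C a)"
  proof (rule measure_pmf.finite_measure_mono)
    show "mono_event e \<inter> set_pmf ?R \<subseteq> (\<Union>a\<in>{1..c}. C a)"
    proof
      fix \<phi> assume \<phi>: "\<phi> \<in> mono_event e \<inter> set_pmf ?R"
      then have "\<phi> x \<in> {1..c}"
        unfolding supp using x assms by (auto simp: PiE_dflt_def)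
      moreover have "\<phi> \<in> C (\<phi> x)"
        using \<phi> x by (auto simp: mono_event_def constant_on_def C_def)
      ultimately show "\<phi> \<in> (\<Union>a\<in>{1..c}. C a)" by blast
    qed
  qed auto
  also have "\<dots> \<le> (\<Sum>a\<in>{1..c}. measure_pmf.prob ?R (C a))"
    by (intro measure_pmf.finite_measure_subadditive_finite) auto
  also have "\<dots> = (\<Sum>a\<in>{1..c}. (1 / real c) ^ card e)"
  proof (rule sum.cong[OF refl])
    fix a assume a: "a \<in> {1..c}"
    have "measure_pmf.prob ?R (C a) =
        (\<Prod>x\<in>V. measure_pmf.prob (pmf_of_set {1..c}) (if x \<in> e then {a} else UNIV))"
      unfolding random_colouring_def C_def using fin by (rule measure_Pi_pmf_Pi)
    also have "\<dots> = (\<Prod>x\<in>V. if x \<in> e then 1 / real c else 1)"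
      using a by (intro prod.cong) (auto simp: measure_pmf_single)
    also have "\<dots> = (1 / real c) ^ card e"
      using fin \<open>e \<subseteq> V\<close> by (simp add: prod.If_cases Int_absorb1)
    finally show "measure_pmf.prob ?R (C a) = (1 / real c) ^ card e" .
  qed
  also have "\<dots> = (1 / real c) ^ (card e - 1)"
  proof -
    have "card e > 0" using fin_e x by (auto simp: card_gt_0_iff)
    then have "(1 / real c) ^ card e = (1 / real c) * (1 / real c) ^ (card e - 1)"
      by (cases "card e") auto
    then show ?thesis using \<open>c \<ge> 1\<close> by simp
  qed
  finally show ?thesis .
qed

text \<open>
  Disjoint edges look at disjoint sets of colours, so \<^const>\<open>edge_nbhd\<close> is a dependency graph for the
  monochromatic events. Avoiding all of them has positive probability, so some outcome in the
  support does it, and the support is \<^term>\<open>colourings V c\<close>.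
\<close>

theorem stable_colouring_exists_if_local_lemma:
  fixes f :: "'a set \<Rightarrow> real"
  assumes fin: "finite V" and E: "E \<subseteq> Pow V" and "c \<ge> 1"
    and f: "f \<in> E \<rightarrow> {0<..<1}"
    and bound: "\<And>e. e \<in> E \<Longrightarrow> measure_pmf.prob (random_colouring V c) (mono_event e)
        \<le> f e * (\<Prod>e'\<in>edge_nbhd E e. 1 - f e')"
  shows "\<exists>\<phi>. stable_colouring V E c \<phi>"
proof -
  let ?R = "random_colouring V c"
  have supp: "set_pmf ?R = PiE_dflt V undefined (\<lambda>_. {1..c})"
    unfolding random_colouring_def using assms by (subst set_Pi_pmf) (simp_all add: o_def)
  have "0 < measure_pmf.prob ?R (space ?R - \<Union>(mono_event ` E))"
  proof (rule measure_pmf.lovasz_local_lemma[where \<Gamma> = "edge_nbhd E" and f = f])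
    show "finite E" using E fin by (meson finite_Pow_iff finite_subset)
    show "0 < f e \<and> f e < 1" if "e \<in> E" for e
      using f that by force
    show "measure_pmf.prob ?R (mono_event e \<inter> (space ?R - \<Union>(mono_event ` S))) =
        measure_pmf.prob ?R (mono_event e) * measure_pmf.prob ?R (space ?R - \<Union>(mono_event ` S))"
      if e: "e \<in> E" and S: "S \<subseteq> E - insert e (edge_nbhd E e)" for e S
      unfolding random_colouring_def
    proof (rule prob_Pi_pmf_indep[OF fin])
      show "e \<subseteq> V" using e E by auto
      show "\<phi> \<in> mono_event e \<longleftrightarrow> \<psi> \<in> mono_event e"
        if "\<And>x. x \<in> e \<Longrightarrow> \<phi> x = \<psi> x" for \<phi> \<psi> :: "'a \<Rightarrow> nat"
        using that by (simp add: mono_event_def constant_on_def)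
      show "\<phi> \<in> space (measure_pmf (Pi_pmf V undefined (\<lambda>_. pmf_of_set {1..c}))) - \<Union>(mono_event ` S) \<longleftrightarrow>
          \<psi> \<in> space (measure_pmf (Pi_pmf V undefined (\<lambda>_. pmf_of_set {1..c}))) - \<Union>(mono_event ` S)"
        if eq: "\<And>x. x \<notin> e \<Longrightarrow> \<phi> x = \<psi> x" for \<phi> \<psi> :: "'a \<Rightarrow> nat"
      proof -
        have "\<phi> \<in> mono_event s \<longleftrightarrow> \<psi> \<in> mono_event s" if "s \<in> S" for s
        proof -
          have "s \<inter> e = {}" using S that by (auto simp: edge_nbhd_def)
          then have "\<forall>x\<in>s. \<phi> x = \<psi> x" using eq by blast
          then show ?thesis by (simp add: mono_event_def constant_on_def)
        qed
        then show ?thesis by auto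
      qed
    qed
  qed (use bound in \<open>auto simp: edge_nbhd_def\<close>)
  then have "set_pmf ?R \<inter> (space ?R - \<Union>(mono_event ` E)) \<noteq> {}"
    by (metis measure_Int_set_pmf Int_commute measure_empty less_irrefl)
  then obtain \<phi> where "\<phi> \<in> set_pmf ?R" and \<phi>: "\<forall>e\<in>E. \<not> \<phi> constant_on e"
    by (auto simp: mono_event_def)
  then have "\<phi> \<in> colourings V c"
    unfolding supp colourings_def by (auto simp: PiE_dflt_def PiE_def extensional_def)
  then show ?thesis using \<phi> by (auto simp: stable_colouring_def)
qed

section \<open>Intersecting lines in the grid\<close>

definition grid_lines :: "nat \<Rightarrow> (nat \<times> nat) set set" where
  "grid_lines k = range (column_line k) \<union> range (row_line k)"

text \<open>Reflection in the diagonal reduces rows to columns.\<close>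

lemma swap_column_line: "prod.swap ` column_line k p = row_line k (prod.swap p)"
  and swap_row_line: "prod.swap ` row_line k p = column_line k (prod.swap p)"
  by (cases p; force simp: column_line_def row_line_def)+

lemma swap_grid_lines: "l \<in> grid_lines k \<Longrightarrow> prod.swap ` l \<in> grid_lines k"
  by (auto simp: grid_lines_def swap_column_line swap_row_line)

text \<open>
  A parallel neighbour starts in the same column at distance at most \<open>k - 1\<close>. A crossing neighbour
  is the row through cell \<open>(i, j + t)\<close> starting at one of the \<open>k\<close> places \<open>i - k + 1, \<dots>, i\<close>. At the
  border of the quadrant truncated subtraction only removes candidates.
\<close>

lemma card_edge_nbhd_column_line:
  assumes "k \<ge> 1"
  shows "finite (edge_nbhd (grid_lines k) (column_line k p))"
    and "card (edge_nbhd (grid_lines k) (column_line k p)) \<le> 2 * k - 2 + k\<^sup>2"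
proof -
  obtain i j where p: "p = (i, j)" by (cases p)
  define P where "P = {i} \<times> ({j + 1 - k..j + k - 1} - {j})"
  define Q where "Q = {i + 1 - k..i} \<times> {j..<j + k}"
  let ?N = "column_line k ` P \<union> row_line k ` Q"
  have sub: "edge_nbhd (grid_lines k) (column_line k p) \<subseteq> ?N"
  proof
    fix l assume l: "l \<in> edge_nbhd (grid_lines k) (column_line k p)"
    then obtain i' j' where "l = column_line k (i', j') \<or> l = row_line k (i', j')"
      by (auto simp: edge_nbhd_def grid_lines_def)
    then show "l \<in> ?N"
    proof
      assume l': "l = column_line k (i', j')"
      have "(i', j') \<in> P"
        using l unfolding l' p P_def by (auto simp: edge_nbhd_def column_line_def)
      then show ?thesis using l' by blast
    next
      assume l': "l = row_line k (i', j')"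
      have "(i', j') \<in> Q"
        using l unfolding l' p Q_def by (auto simp: edge_nbhd_def column_line_def row_line_def)
      then show ?thesis using l' by blast
    qed
  qed
  have fin: "finite P" "finite Q" by (auto simp: P_def Q_def)
  then show "finite (edge_nbhd (grid_lines k) (column_line k p))"
    using sub by (auto intro: finite_subset)
  have "card (edge_nbhd (grid_lines k) (column_line k p)) \<le> card ?N"
    using fin by (intro card_mono sub) auto
  also have "\<dots> \<le> card P + card Q"
    using fin by (meson add_mono card_Un_le card_image_le le_trans)
  also have "card P \<le> 2 * k - 2"
  proof -
    have "j \<in> {j + 1 - k..j + k - 1}" using assms by auto
    then have "card P = card {j + 1 - k..j + k - 1} - 1"
      by (simp only: P_def card_cartesian_product_singleton card_Diff_singleton)
    then show ?thesis by simp
  qed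
  also have "card Q \<le> k * k"
    unfolding Q_def card_cartesian_product by (intro mult_mono) auto
  finally show "card (edge_nbhd (grid_lines k) (column_line k p)) \<le> 2 * k - 2 + k\<^sup>2"
    by (simp add: power2_eq_square)
qed

lemma card_edge_nbhd_grid_lines:
  assumes "k \<ge> 1" "l \<in> grid_lines k"
  shows "finite (edge_nbhd (grid_lines k) l) \<and> card (edge_nbhd (grid_lines k) l) \<le> 2 * k - 2 + k\<^sup>2"
proof -
  consider p where "l = column_line k p" | p where "l = row_line k p"
    using assms by (auto simp: grid_lines_def)
  then show ?thesis
  proof cases
    case 1
    then show ?thesis using card_edge_nbhd_column_line assms by auto
  next
    case 2
    let ?N = "edge_nbhd (grid_lines k) (column_line k (prod.swap p))"
    have l: "prod.swap ` l = column_line k (prod.swap p)"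
      using 2 by (simp add: swap_row_line)
    have sub: "edge_nbhd (grid_lines k) l \<subseteq> (`) prod.swap ` ?N"
    proof
      fix l' assume l': "l' \<in> edge_nbhd (grid_lines k) l"
      have "prod.swap ` l' \<in> ?N"
        using l' swap_grid_lines unfolding l[symmetric] edge_nbhd_def
        by (auto simp: inj_image_eq_iff image_Int[symmetric])
      moreover have "l' = prod.swap ` prod.swap ` l'" by (simp add: image_image)
      ultimately show "l' \<in> (`) prod.swap ` ?N" by blast
    qed
    have fin: "finite ?N" using card_edge_nbhd_column_line assms by auto
    have "card (edge_nbhd (grid_lines k) l) \<le> card ((`) prod.swap ` ?N)"
      using fin by (intro card_mono sub) auto
    also have "\<dots> \<le> card ?N" using fin by (rule card_image_le)
    also have "\<dots> \<le> 2 * k - 2 + k\<^sup>2" using card_edge_nbhd_column_line assms by auto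
    finally show ?thesis using sub fin by (auto intro: finite_subset)
  qed
qed

lemma card_edge_nbhd_grid:
  assumes "candy_crush_grid m n k V E" "k \<ge> 1" "e \<in> E"
  shows "card (edge_nbhd E e) \<le> 2 * k - 2 + k\<^sup>2"
proof -
  have "E \<subseteq> grid_lines k" using assms by (auto simp: candy_crush_grid_def grid_lines_def)
  then have "edge_nbhd E e \<subseteq> edge_nbhd (grid_lines k) e" "e \<in> grid_lines k"
    using assms by (auto simp: edge_nbhd_def)
  then show ?thesis
    using card_edge_nbhd_grid_lines[of k e] assms by (meson card_mono le_trans)
qed

section \<open>Stable colourings of Candy Crush grids\<close>

theorem theorem4:
  fixes k c m n :: nat
    and V :: "(nat \<times> nat) set" and E :: "(nat \<times> nat) set set"
  assumes "k \<ge> 2" and "c \<ge> 1"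
    and "1 / real c \<le>
          (1 / (real k ^ 2 + 2 * real k - 1)) powr (1 / (real k - 1)) *
          (1 - 1 / (real k ^ 2 + 2 * real k - 1))
            powr ((2 * real k - 2 + real k ^ 2) / (real k - 1))"
    and "candy_crush_grid m n k V E"
  shows "(\<exists>f :: (nat \<times> nat) set \<Rightarrow> real. f \<in> E \<rightarrow> {0<..<1} \<and>
           (\<forall>e\<in>E. measure_pmf.prob (random_colouring V c) (mono_event e)
                    \<le> f e * (\<Prod>e'\<in>edge_nbhd E e. 1 - f e')))
         \<and> (\<exists>\<phi>. stable_colouring V E c \<phi>)"
proof -
  define p where "p = 1 / (real k ^ 2 + 2 * real k - 1)"
  define D where "D = 2 * k - 2 + k\<^sup>2"
  have D: "real D = 2 * real k - 2 + real k ^ 2" using assms(1) by (simp add: D_def of_nat_diff)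
  have "real k ^ 2 + 2 * real k - 1 > 1"
  proof -
    have "real k \<ge> 2" using assms(1) by simp
    then show ?thesis using zero_le_power2[of "real k"] by linarith
  qed
  then have p: "0 < p" "p < 1" by (simp_all add: p_def)
  have V: "finite V" "E \<subseteq> Pow V"
    using assms(4) finite_subset[of V "{1..n} \<times> {1..m}"] by (auto simp: candy_crush_grid_def)
  have "(1 / real c) ^ (k - 1) \<le>
      (p powr (1 / (real k - 1)) * (1 - p) powr (real D / (real k - 1))) ^ (k - 1)"
    using assms(3) unfolding p_def D by (intro power_mono) auto
  also have "\<dots> = p * (1 - p) ^ D"
  proof -
    have "(x powr (y / (real k - 1))) ^ (k - 1) = x powr y" if "x > 0" for x y :: real
      using that assms(1) by (simp add: powr_realpow[symmetric] powr_powr of_nat_diff)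
    from this[of p 1] this[of "1 - p" "real D"] show ?thesis
      using p by (simp add: power_mult_distrib powr_realpow)
  qed
  finally have c: "(1 / real c) ^ (k - 1) \<le> p * (1 - p) ^ D" .
  have bound: "measure_pmf.prob (random_colouring V c) (mono_event e)
      \<le> p * (\<Prod>e'\<in>edge_nbhd E e. 1 - p)" if e: "e \<in> E" for e
  proof -
    have "card e = k" using candy_crush_grid_uniform assms(4) e by blast
    then have "measure_pmf.prob (random_colouring V c) (mono_event e) \<le> (1 / real c) ^ (k - 1)"
      using prob_mono_event_le[of V e c] V e assms(1,2) by fastforce
    also note c
    also have "p * (1 - p) ^ D \<le> p * (1 - p) ^ card (edge_nbhd E e)"
      using p card_edge_nbhd_grid[OF assms(4) _ e] assms(1)
      by (intro mult_left_mono power_decreasing) (auto simp: D_def)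
    finally show ?thesis by simp
  qed
  have "\<exists>\<phi>. stable_colouring V E c \<phi>"
    using V assms(2) p bound
    by (intro stable_colouring_exists_if_local_lemma[where f = "\<lambda>_. p"]) auto
  moreover have "(\<lambda>_. p) \<in> E \<rightarrow> {0<..<1}" using p by auto
  ultimately show ?thesis using bound by blast
qed

end
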